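(* There exist polynomials $f, g\in\mathbb{C}[x]$ of degree $6$ with identical critical portraits but different monodromy groups (i.e. $MG(f)$ and $MG(g)$ are not isomorphic). Moreover, one can choose $f$ and $g$ to have real coefficients.
   Context: Let $f\in\mathbb{C}[x]$ have degree $d\geq 1$ and let $\mathcal V$ be its set of critical values. For $p\in\mathbb{C}\setminus \mathcal V$, lifting closed loops at $p$ in $\mathbb{C}\setminus \mathcal V$ through the covering $f:\mathbb{C}\setminus f^{-1}(\mathcal V)\to\mathbb{C}\setminus \mathcal V$ gives an action of $\pi_1(\mathbb{C}\setminus \mathcal V,p)$ on the $d$ points of $f^{-1}(p)$; the resulting group of permutations, viewed as a subgroup of $S_d$ (well defined up to conjugacy, independently of $p$), is the monodromy group $MG(f)$. The critical portrait of $f$ is the number and multiplicity of its critical values: for each critical value $v\in \mathcal V$ one records the multiset of local degrees (orders) of $f$ at the critical points lying over $v$, and the critical portrait is the collection (multiset, indexed by the critical values) of these multisets. Two polynomials have identical critical portraits if there is a bijection between their sets of critical values under which corresponding critical values have the same multiset of local degrees at the critical points above them. *)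

theory Defs
  imports
    "HOL-Analysis.Analysis"
    "HOL-Algebra.Bij"
    "HOL-Computational_Algebra.Polynomial"
    "HOL-Library.Multiset"
begin

definition critical_points :: "complex poly \<Rightarrow> complex set" where
  "critical_points f = {z. poly (pderiv f) z = 0}"

definition critical_values :: "complex poly \<Rightarrow> complex set" where
  "critical_values f = poly f ` critical_points f"

definition local_degree :: "complex poly \<Rightarrow> complex \<Rightarrow> nat" where
  "local_degree f z = Polynomial.order z (f - [:poly f z:])"

text \<open>For nonconstant \<open>f\<close> there are only finitely many critical points, so \<open>mset_set\<close> is
  meaningful below.\<close>

definition critical_degrees :: "complex poly \<Rightarrow> complex \<Rightarrow> nat multiset" where
  "critical_degrees f v =
     image_mset (local_degree f) (mset_set {z \<in> critical_points f. poly f z = v})"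

definition same_critical_portrait :: "complex poly \<Rightarrow> complex poly \<Rightarrow> bool" where
  "same_critical_portrait f g \<longleftrightarrow>
     (\<exists>b. bij_betw b (critical_values f) (critical_values g) \<and>
          (\<forall>v \<in> critical_values f. critical_degrees f v = critical_degrees g (b v)))"

definition fibre :: "complex poly \<Rightarrow> complex \<Rightarrow> complex set" where
  "fibre f p = {z. poly f z = p}"

definition loops_at :: "complex poly \<Rightarrow> complex \<Rightarrow> (real \<Rightarrow> complex) set" where
  "loops_at f p = {\<gamma>. path \<gamma> \<and> path_image \<gamma> \<subseteq> - critical_values f \<and>
                       pathstart \<gamma> = p \<and> pathfinish \<gamma> = p}"

definition is_lift :: "complex poly \<Rightarrow> (real \<Rightarrow> complex) \<Rightarrow> (real \<Rightarrow> complex) \<Rightarrow> bool" where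
  "is_lift f \<gamma> \<delta> \<longleftrightarrow> path \<delta> \<and> path_image \<delta> \<subseteq> - (poly f -` critical_values f) \<and>
                    (\<forall>t \<in> {0..1}. poly f (\<delta> t) = \<gamma> t)"

text \<open>The endpoint is unique because \<open>poly f\<close> is a covering map away from the critical values.\<close>

definition monodromy_perm ::
    "complex poly \<Rightarrow> complex \<Rightarrow> (real \<Rightarrow> complex) \<Rightarrow> complex \<Rightarrow> complex" where
  "monodromy_perm f p \<gamma> =
     (\<lambda>x \<in> fibre f p. THE y. \<exists>\<delta>. is_lift f \<gamma> \<delta> \<and> pathstart \<delta> = x \<and> pathfinish \<delta> = y)"

text \<open>The image of the fundamental group in the permutations of the fibre over the base point \<open>p\<close>.
  Homotopic loops induce the same permutation, so the image can be taken over the loops themselves;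
  it does not depend on whether the action is read as a left or a right action.\<close>

definition monodromy_group :: "complex poly \<Rightarrow> complex \<Rightarrow> (complex \<Rightarrow> complex) monoid" where
  "monodromy_group f p = (BijGroup (fibre f p))\<lparr>carrier := monodromy_perm f p ` loops_at f p\<rparr>"

end

theory Submission
  imports Defs "HOL-Complex_Analysis.Complex_Analysis"
    "HOL-Computational_Algebra.Fundamental_Theorem_Algebra"
begin

text \<open>The two plane trees with vertex degrees 4, 1, 1 and 2, 2, 1, 1 give sextics
  \<open>f = 2x\<^sup>6 - 3x\<^sup>4\<close> and \<open>g = 135x\<^sup>6 - 162x\<^sup>5 + 135x\<^sup>4\<close> with the same critical portrait. Their
  monodromy groups are separated by their centres. As \<open>f\<close> is even, negation commutes with all
  monodromy permutations of \<open>f\<close>, and it is itself one of them: it is the cube of the monodromy at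
  infinity. A central element of \<open>MG(g)\<close>, on the other hand, extends to a holomorphic deck
  transformation of \<open>g\<close>. This map has removable singularities and linear growth, so it is affine, and the
  only affine map that preserves \<open>g\<close> is the identity. Hence \<open>MG(g)\<close> has trivial centre.\<close>

section \<open>Polynomials as covering maps\<close>

lemma poly_surj_complex:
  fixes f :: "complex poly"
  assumes "degree f > 0"
  obtains z where "poly f z = v"
proof -
  have "degree f \<noteq> 0"
    using assms by simp
  then have "\<not> constant (poly f)"
    by (simp add: constant_degree)
  then have "\<not> constant (poly (f + [:-v:]))"
    by (simp add: constant_def)
  then obtain z where "poly (f + [:-v:]) z = 0"
    using fundamental_theorem_of_algebra by blast
  then show ?thesis
    by (intro that[of z]) simp
qed

lemma holomorphic_on_poly_fun [simp]: "poly f holomorphic_on S"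
  using poly_holomorphic_on[of "\<lambda>z. z" S f] by simp

lemma finite_critical_values:
  assumes "degree f > 0"
  shows "finite (critical_values f)"
proof -
  have "pderiv f \<noteq> 0"
    using assms by (simp add: pderiv_eq_0_iff)
  then show ?thesis
    by (simp add: critical_values_def critical_points_def poly_roots_finite)
qed

lemma finite_fibre:
  assumes "degree f > 0"
  shows "finite (fibre f p)"
proof -
  have "f - [:p:] \<noteq> 0"
    using assms by auto
  then have "finite {z. poly (f - [:p:]) z = 0}"
    by (rule poly_roots_finite)
  then show ?thesis
    by (simp add: fibre_def)
qed

lemma finite_critical_fibres:
  assumes "degree f > 0"
  shows "finite (poly f -` critical_values f)"
proof -
  have "poly f -` critical_values f = (\<Union>v\<in>critical_values f. fibre f v)"
    by (auto simp: fibre_def)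
  then show ?thesis
    by (simp add: finite_critical_values finite_fibre assms)
qed

lemma compact_poly_preimage:
  fixes f :: "complex poly"
  assumes "degree f > 0" "compact K"
  shows "compact {z. poly f z \<in> K}"
proof -
  have "f \<noteq> 0"
    using assms by auto
  then show ?thesis
    using proper_map_polyfun_univ[OF \<open>compact K\<close>, of "coeff f" "degree f" "degree f"] assms
    by (simp add: poly_altdef)
qed

text \<open>Properness at work: the points outside \<open>U\<close> with value in a closed disc
  around \<open>x\<close> form a compact set, so their values keep a positive distance from
  \<open>x\<close>. This is what ensures that the sheets built around a fibre exhaust the preimage
  of a small disc.\<close>

lemma poly_inverse_nbhd:
  fixes f :: "complex poly"
  assumes "degree f > 0" "open U" "fibre f x \<subseteq> U"
  obtains e where "e > 0" "poly f -` ball x e \<subseteq> U"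
proof -
  define K where "K = poly f ` ({z. poly f z \<in> cball x 1} - U)"
  have "compact ({z. poly f z \<in> cball x 1} - U)"
    by (intro compact_diff compact_poly_preimage assms compact_cball)
  then have "compact K"
    unfolding K_def by (intro compact_continuous_image continuous_intros)
  moreover have "x \<notin> K"
    using assms(3) by (auto simp: K_def fibre_def)
  ultimately obtain d where "d > 0" "ball x d \<subseteq> - K"
    using open_contains_ball[of "- K"] compact_imp_closed[of K]
    by (metis ComplI open_Compl)
  then show ?thesis
    \<comment> \<open>The radius is capped at 1 because \<open>K\<close> only records values in
      \<open>cball x 1\<close>.\<close>
    by (intro that[of "min d 1"]) (force simp: K_def)+
qed

lemma finite_disjoint_balls:
  fixes F :: "'a::metric_space set"
  assumes "finite F"
  obtains d where "d > 0" "pairwise (\<lambda>a b. ball a d \<inter> ball b d = {}) F"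
proof -
  have "\<exists>d>0. \<forall>a\<in>F. \<forall>b\<in>F. a \<noteq> b \<longrightarrow> 2 * d \<le> dist a b"
  proof -
    have "\<forall>a\<in>F. \<exists>d>0. \<forall>b\<in>F. b \<noteq> a \<longrightarrow> d \<le> dist a b"
      using finite_set_avoid[OF assms] by metis
    then obtain d where d: "\<And>a. a \<in> F \<Longrightarrow> d a > 0" 
        "\<And>a b. a \<in> F \<Longrightarrow> b \<in> F \<Longrightarrow> b \<noteq> a \<Longrightarrow> d a \<le> dist a b"
      by metis
    define m where "m = Min (insert 1 (d ` F)) / 2"
    have "m > 0" "\<And>a. a \<in> F \<Longrightarrow> 2 * m \<le> d a"
      using assms d by (auto simp: m_def)
    then show ?thesis
      using d(2) by (metis order_trans)
  qed
  then obtain d where d: "d > 0" "\<And>a b. a \<in> F \<Longrightarrow> b \<in> F \<Longrightarrow> a \<noteq> b \<Longrightarrow> 2 * d \<le> dist a b"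
    by blast
  have "pairwise (\<lambda>a b. ball a d \<inter> ball b d = {}) F"
  proof (rule pairwiseI)
    fix a b assume "a \<in> F" "b \<in> F" "a \<noteq> b"
    then have "2 * d \<le> dist a b" by (rule d)
    then show "ball a d \<inter> ball b d = {}"
      by (intro disjoint_ballI) simp
  qed
  with \<open>d > 0\<close> show ?thesis by (rule that)
qed

text \<open>Over a regular value the derivative is nonzero at each point of the finite fibre, so
  \<open>poly f\<close> is injective on small disjoint discs around these points. Cutting the discs
  down to a common image gives the sheets.\<close>

theorem covering_space_poly:
  assumes "degree f > 0"
  shows "covering_space (- (poly f -` critical_values f)) (poly f) (- critical_values f)"
proof
  show "continuous_on (- (poly f -` critical_values f)) (poly f)"
    by (intro continuous_intros)
  show "poly f ` (- (poly f -` critical_values f)) = - critical_values f"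
  proof (intro equalityI subsetI)
    fix v assume "v \<in> - critical_values f"
    moreover obtain z where "poly f z = v"
      using poly_surj_complex[OF assms] .
    ultimately show "v \<in> poly f ` (- (poly f -` critical_values f))"
      by auto
  qed auto
  fix x assume x: "x \<in> - critical_values f"
  define F where "F = fibre f x"
  have "finite F"
    unfolding F_def by (rule finite_fibre[OF assms])
  then obtain d where d: "d > 0" "pairwise (\<lambda>a b. ball a d \<inter> ball b d = {}) F"
    by (rule finite_disjoint_balls)
  have "\<exists>r>0. inj_on (poly f) (ball z r)" if "z \<in> F" for z
  proof -
    have "deriv (poly f) z \<noteq> 0"
      using x that DERIV_imp_deriv[OF poly_DERIV[of f z]]
      by (auto simp: F_def fibre_def critical_values_def critical_points_def)
    then obtain r where "r > 0" "inj_on (poly f) (ball z r)"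
      using has_complex_derivative_locally_injective[of "poly f" UNIV z] by auto
    then show ?thesis by blast
  qed
  then obtain r where r: "\<And>z. z \<in> F \<Longrightarrow> r z > 0" "\<And>z. z \<in> F \<Longrightarrow> inj_on (poly f) (ball z (r z))"
    using bchoice[of F "\<lambda>z r. r > 0 \<and> inj_on (poly f) (ball z r)"] by blast
  define U where "U z = ball z (min (r z) d)" for z
  have U: "open (U z)" "z \<in> F \<Longrightarrow> z \<in> U z" "z \<in> F \<Longrightarrow> inj_on (poly f) (U z)" for z
    using r d by (auto simp: U_def intro: inj_on_subset[OF r(2)])
  have dis: "U a \<inter> U b = {}" if "a \<in> F" "b \<in> F" "a \<noteq> b" for a b
  proof -
    have "ball a d \<inter> ball b d = {}"
      using d(2) that by (simp add: pairwise_def)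
    moreover have "U c \<subseteq> ball c d" for c
      by (auto simp: U_def)
    ultimately show ?thesis by blast
  qed
  have opf: "open (poly f ` W)" if "z \<in> F" "open W" "W \<subseteq> U z" for z W
    using that U(3)[of z] by (intro open_mapping_thm3) (auto intro: inj_on_subset)
  obtain e where e: "e > 0" "poly f -` ball x e \<subseteq> (\<Union>z\<in>F. U z)"
  proof (rule poly_inverse_nbhd[OF assms])
    show "open (\<Union>z\<in>F. U z)" "fibre f x \<subseteq> (\<Union>z\<in>F. U z)"
      using U by (auto simp: F_def)
  qed
  \<comment> \<open>The ball keeps every preimage of \<open>T\<close> inside the discs
    \<open>U z\<close>, and the intersection of images makes each disc reach all of
    \<open>T\<close>.\<close>
  define T where "T = ball x e \<inter> (\<Inter>z\<in>F. poly f ` U z) \<inter> - critical_values f"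
  have "open (\<Inter>z\<in>F. poly f ` U z)"
    using opf U(1) \<open>finite F\<close> by (intro open_INT) auto
  moreover have "open (- critical_values f)"
    using finite_imp_closed[OF finite_critical_values[OF assms]] by (rule open_Compl)
  ultimately have "open T"
    unfolding T_def by (intro open_Int open_ball)
  define W where "W z = U z \<inter> poly f -` T" for z
  have W: "open (W z)" for z
    unfolding W_def by (intro open_Int U open_vimage \<open>open T\<close> continuous_intros)
  have img: "poly f ` W z = T" if "z \<in> F" for z
  proof -
    have "T \<subseteq> poly f ` U z"
      using that by (auto simp: T_def)
    then show ?thesis
      by (auto simp: W_def)
  qed
  show "\<exists>T. x \<in> T \<and> openin (top_of_set (- critical_values f)) T \<and>
             (\<exists>v. \<Union> v = - (poly f -` critical_values f) \<inter> poly f -` T \<and>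
                  (\<forall>u\<in>v. openin (top_of_set (- (poly f -` critical_values f))) u) \<and>
                  pairwise disjnt v \<and> (\<forall>u\<in>v. \<exists>q. homeomorphism u T (poly f) q))"
  proof (intro exI[of _ T] conjI exI[of _ "W ` F"] ballI)
    show "x \<in> T"
      using x e U(2) by (force simp: T_def F_def fibre_def)
    show "openin (top_of_set (- critical_values f)) T"
      using \<open>open T\<close> by (intro open_subset) (auto simp: T_def)
    show "\<Union> (W ` F) = - (poly f -` critical_values f) \<inter> poly f -` T"
      using e by (auto simp: W_def T_def)
    show "pairwise disjnt (W ` F)"
      using dis by (fastforce simp: pairwise_def disjnt_def W_def)
  next
    fix u assume "u \<in> W ` F"
    then obtain z where z: "z \<in> F" "u = W z" by auto
    then show "openin (top_of_set (- (poly f -` critical_values f))) u"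
      using W by (intro open_subset) (auto simp: W_def T_def)
    have "inj_on (poly f) (W z)"
      using U(3)[OF z(1)] by (rule inj_on_subset) (auto simp: W_def)
    then obtain q where "homeomorphism (W z) (poly f ` W z) (poly f) q"
      using invariance_of_domain_homeomorphism[OF W continuous_on_poly[OF continuous_on_id]] by auto
    then show "\<exists>q. homeomorphism u T (poly f) q"
      using img[OF z(1)] z(2) by auto
  qed
qed

section \<open>Path lifting and the monodromy permutations\<close>

lemma is_lift_exists:
  assumes "degree f > 0" "path \<gamma>" "path_image \<gamma> \<subseteq> - critical_values f"
    and "poly f x = pathstart \<gamma>"
  obtains \<delta> where "is_lift f \<gamma> \<delta>" "pathstart \<delta> = x"
proof -
  have "x \<in> - (poly f -` critical_values f)"
    using assms pathstart_in_path_image[of \<gamma>] by auto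
  then show ?thesis
    using covering_space_lift_path_strong[OF covering_space_poly[OF assms(1)] _ assms(2,3)] 
      assms(4) that unfolding is_lift_def by metis
qed

text \<open>Agreement can only be expected on \<open>{0..1}\<close>, since \<open>is_lift\<close>
  leaves the values elsewhere arbitrary.\<close>

lemma is_lift_unique:
  assumes "degree f > 0" "is_lift f \<gamma> \<delta>" "is_lift f \<gamma> \<delta>'" "pathstart \<delta> = pathstart \<delta>'"
    and "t \<in> {0..1}"
  shows "\<delta> t = \<delta>' t"
proof (rule covering_space_lift_unique[where a = 0 and T = "{0..1}" and f = "\<lambda>t. poly f (\<delta> t)",
      OF covering_space_poly[OF assms(1)]])
  show "\<delta> 0 = \<delta>' 0"
    using assms(4) by (simp add: pathstart_def)
  show "continuous_on {0..1} (\<lambda>t. poly f (\<delta> t))"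
    using assms(2) by (auto simp: is_lift_def path_def intro!: continuous_intros)
  show "poly f (\<delta> t) = poly f (\<delta>' t)" if "t \<in> {0..1}" for t
    using assms(2,3) that by (simp add: is_lift_def)
  show "(\<lambda>t. poly f (\<delta> t)) \<in> {0..1} \<rightarrow> - critical_values f"
    using assms(2) by (auto simp: is_lift_def path_image_def)
  show "\<delta> \<in> {0..1} \<rightarrow> - (poly f -` critical_values f)" "\<delta>' \<in> {0..1} \<rightarrow> - (poly f -` critical_values f)"
    using assms(2,3) by (auto simp: is_lift_def path_image_def)
  show "continuous_on {0..1} \<delta>" "continuous_on {0..1} \<delta>'"
    using assms(2,3) by (auto simp: is_lift_def path_def)
qed (use assms(5) in auto)

lemma is_lift_comp:
  assumes "path \<delta>" "path_image \<delta> \<subseteq> - (poly f -` critical_values f)"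
  shows "is_lift f (poly f \<circ> \<delta>) \<delta>"
  using assms by (simp add: is_lift_def)

lemma is_lift_join:
  assumes "is_lift f \<gamma> \<delta>" "is_lift f \<gamma>' \<delta>'" "pathfinish \<delta> = pathstart \<delta>'"
  shows "is_lift f (\<gamma> +++ \<gamma>') (\<delta> +++ \<delta>')"
proof -
  have "poly f ((\<delta> +++ \<delta>') t) = (\<gamma> +++ \<gamma>') t" if "t \<in> {0..1}" for t
    using assms that by (auto simp: joinpaths_def is_lift_def)
  then show ?thesis
    using assms by (simp add: is_lift_def path_image_join)
qed

lemma is_lift_reversepath:
  assumes "is_lift f \<gamma> \<delta>"
  shows "is_lift f (reversepath \<gamma>) (reversepath \<delta>)"
proof -
  have "poly f (reversepath \<delta> t) = reversepath \<gamma> t" if "t \<in> {0..1}" for t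
    using assms that by (simp add: reversepath_def is_lift_def)
  then show ?thesis
    using assms by (simp add: is_lift_def)
qed

text \<open>Eliminates the description operator: by uniqueness any single explicit lift computes the
  permutation at its starting point.\<close>

lemma monodromy_perm_lift:
  assumes "degree f > 0" "is_lift f \<gamma> \<delta>" "poly f (pathstart \<delta>) = p"
  shows "monodromy_perm f p \<gamma> (pathstart \<delta>) = pathfinish \<delta>"
proof -
  have "pathfinish \<delta>' = pathfinish \<delta>" if "is_lift f \<gamma> \<delta>'" "pathstart \<delta>' = pathstart \<delta>" for \<delta>'
    using is_lift_unique[OF assms(1) that(1) assms(2) that(2), of 1] by (simp add: pathfinish_def)
  then have "(THE y. \<exists>\<delta>'. is_lift f \<gamma> \<delta>' \<and> pathstart \<delta>' = pathstart \<delta> \<and> pathfinish \<delta>' = y) = pathfinish \<delta>"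
    using assms(2) by (intro the_equality) blast+
  then show ?thesis
    using assms(3) by (simp add: monodromy_perm_def fibre_def)
qed

lemma loop_lift:
  assumes "degree f > 0" "\<gamma> \<in> loops_at f p" "x \<in> fibre f p"
  obtains \<delta> where "is_lift f \<gamma> \<delta>" "pathstart \<delta> = x" "monodromy_perm f p \<gamma> x = pathfinish \<delta>"
    "pathfinish \<delta> \<in> fibre f p"
proof -
  obtain \<delta> where \<delta>: "is_lift f \<gamma> \<delta>" "pathstart \<delta> = x"
    using assms is_lift_exists[OF assms(1), of \<gamma> x] by (auto simp: loops_at_def fibre_def)
  moreover have "poly f (pathfinish \<delta>) = pathfinish \<gamma>"
    using \<delta>(1) by (simp add: is_lift_def pathfinish_def)
  ultimately show ?thesis
    using that monodromy_perm_lift[OF assms(1), of \<gamma> \<delta> p] assms(2,3)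
    by (auto simp: fibre_def loops_at_def)
qed

lemma monodromy_perm_reversepath:
  assumes "degree f > 0" "\<gamma> \<in> loops_at f p" "x \<in> fibre f p"
  shows "monodromy_perm f p (reversepath \<gamma>) (monodromy_perm f p \<gamma> x) = x"
proof -
  obtain \<delta> where \<delta>: "is_lift f \<gamma> \<delta>" "pathstart \<delta> = x" "monodromy_perm f p \<gamma> x = pathfinish \<delta>"
      "pathfinish \<delta> \<in> fibre f p"
    using loop_lift[OF assms] .
  show ?thesis
    using monodromy_perm_lift[OF assms(1) is_lift_reversepath[OF \<delta>(1)]] \<delta> by (simp add: fibre_def)
qed

text \<open>The reversed loop undoes the map, which gives injectivity, and finiteness of the fibre
  gives surjectivity. Membership in \<open>Bij\<close> is what makes the product in
  \<open>BijGroup\<close> an actual composition.\<close>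

lemma monodromy_perm_Bij:
  assumes "degree f > 0" "\<gamma> \<in> loops_at f p"
  shows "monodromy_perm f p \<gamma> \<in> Bij (fibre f p)"
proof -
  have "monodromy_perm f p \<gamma> ` fibre f p \<subseteq> fibre f p"
    using loop_lift[OF assms] by (metis image_subsetI)
  moreover have "inj_on (monodromy_perm f p \<gamma>) (fibre f p)"
    using monodromy_perm_reversepath[OF assms] by (rule inj_on_inverseI)
  ultimately have "bij_betw (monodromy_perm f p \<gamma>) (fibre f p) (fibre f p)"
    using finite_fibre[OF assms(1)] by (simp add: bij_betw_def endo_inj_surj)
  then show ?thesis
    by (simp add: Bij_def monodromy_perm_def)
qed

lemma monodromy_group_mult:
  assumes "degree f > 0" "\<gamma> \<in> loops_at f p" "\<gamma>' \<in> loops_at f p"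
  shows "monodromy_perm f p \<gamma> \<otimes>\<^bsub>monodromy_group f p\<^esub> monodromy_perm f p \<gamma>' =
    compose (fibre f p) (monodromy_perm f p \<gamma>) (monodromy_perm f p \<gamma>')"
  using assms by (simp add: monodromy_group_def BijGroup_def monodromy_perm_Bij)

lemma carrier_monodromy_group:
  "carrier (monodromy_group f p) = monodromy_perm f p ` loops_at f p"
  by (simp add: monodromy_group_def)

section \<open>Deck transformations\<close>

text \<open>Near infinity the modulus of the polynomial is comparable to the \<open>n\<close>-th
  power of the modulus of its argument, so points of one fibre have comparable sizes. The bound will
  control deck transformations both at the punctures and at infinity.\<close>

lemma poly_fibre_growth:
  fixes f :: "complex poly"
  assumes "degree f > 0"
  obtains C where "C > 0" "\<And>w z. poly f w = poly f z \<Longrightarrow> cmod w \<le> C * (1 + cmod z)"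
proof -
  define n l where "n = degree f" and "l = cmod (lead_coeff f)"
  define M where "M = (\<Sum>i\<le>n. cmod (coeff f i))"
  have "l > 0"
    using assms by (auto simp: l_def)
  have "M \<ge> 0"
    by (simp add: M_def sum_nonneg)
  have upper: "cmod (poly f z) \<le> M * (1 + cmod z) ^ n" for z
  proof -
    have "cmod (poly f z) \<le> (\<Sum>i\<le>n. cmod (coeff f i * z ^ i))"
      unfolding poly_altdef n_def by (rule norm_sum)
    also have "\<dots> \<le> (\<Sum>i\<le>n. cmod (coeff f i) * (1 + cmod z) ^ n)"
    proof (intro sum_mono)
      fix i assume "i \<in> {..n}"
      have "cmod z ^ i \<le> (1 + cmod z) ^ i"
        by (intro power_mono) auto
      also have "\<dots> \<le> (1 + cmod z) ^ n"
        using \<open>i \<in> {..n}\<close> by (intro power_increasing) auto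
      finally show "cmod (coeff f i * z ^ i) \<le> cmod (coeff f i) * (1 + cmod z) ^ n"
        by (simp add: norm_mult norm_power mult_left_mono)
    qed
    finally show ?thesis
      by (simp add: M_def sum_distrib_right)
  qed
  have "eventually (\<lambda>w. dist (poly f w / w ^ n) (lead_coeff f) < l / 2) at_infinity"
    unfolding n_def using poly_divide_tendsto_aux[of f] \<open>l > 0\<close> by (intro tendstoD) auto
  then obtain R where R: "\<And>w. cmod w \<ge> R \<Longrightarrow> dist (poly f w / w ^ n) (lead_coeff f) < l / 2"
    by (auto simp: eventually_at_infinity)
  have lower: "l / 2 * cmod w ^ n \<le> cmod (poly f w)" if "cmod w \<ge> R" "cmod w > 0" for w
  proof -
    have "l - cmod (poly f w / w ^ n) \<le> dist (poly f w / w ^ n) (lead_coeff f)"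
      unfolding l_def dist_norm by (metis norm_triangle_ineq2 norm_minus_commute)
    then have "l / 2 \<le> cmod (poly f w) / cmod w ^ n"
      using R[OF that(1)] by (simp add: norm_divide norm_power)
    then show ?thesis
      using that(2) by (simp add: pos_le_divide_eq)
  qed
  \<comment> \<open>\<open>R\<close> makes the lower bound applicable to \<open>w\<close>, 1 gives
    \<open>C \<le> C ^ n\<close>, and \<open>2 * M / l\<close> lets the lower bound at
    \<open>w\<close> exceed the upper bound at \<open>z\<close>.\<close>
  define C where "C = max R (max 1 (2 * M / l))"
  have C: "C \<ge> R" "C \<ge> 1" "C * l \<ge> 2 * M"
  proof -
    have "C \<ge> 2 * M / l"
      by (simp add: C_def)
    then show "C * l \<ge> 2 * M"
      using \<open>l > 0\<close> by (simp add: pos_divide_le_eq)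
  qed (simp_all add: C_def)
  have "cmod w \<le> C * (1 + cmod z)" if eq: "poly f w = poly f z" for w z
  proof (rule ccontr)
    assume "\<not> cmod w \<le> C * (1 + cmod z)"
    then have w: "C * (1 + cmod z) < cmod w" by simp
    have "C \<le> C * (1 + cmod z)"
      using C by simp
    with w C have "cmod w \<ge> R" "cmod w > 0" by linarith+
    then have "l / 2 * cmod w ^ n \<le> M * (1 + cmod z) ^ n"
      using lower[of w] upper[of z] eq by simp
    also have "\<dots> \<le> (C * l / 2) * (1 + cmod z) ^ n"
      using C by (intro mult_right_mono) auto
    also have "\<dots> \<le> (C ^ n * l / 2) * (1 + cmod z) ^ n"
      using C \<open>l > 0\<close> assms self_le_power[of C n]
      by (intro mult_right_mono divide_right_mono) (auto simp: n_def)
    also have "\<dots> = l / 2 * (C * (1 + cmod z)) ^ n"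
      by (simp add: power_mult_distrib)
    also have "\<dots> < l / 2 * cmod w ^ n"
      using w C assms \<open>l > 0\<close> by (intro mult_strict_left_mono power_strict_mono) (auto simp: n_def)
    finally show False by simp
  qed
  with C show ?thesis by (intro that[of C]) auto
qed

lemma poly_comp_loop:
  assumes "path r" "path_image r \<subseteq> - (poly f -` critical_values f)"
    "pathstart r \<in> fibre f p" "pathfinish r \<in> fibre f p"
  shows "poly f \<circ> r \<in> loops_at f p"
proof -
  have "path (poly f \<circ> r)"
    using assms(1) by (intro path_continuous_image continuous_intros)
  then show ?thesis
    using assms(2-) by (auto simp: loops_at_def fibre_def path_image_compose pathstart_compose pathfinish_compose)
qed

text \<open>This is the lifting criterion applied to \<open>poly f\<close> along itself. The
  required inclusion between the images of the fundamental groups based at \<open>x\<close> and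
  \<open>y\<close> says that every loop at \<open>p\<close> whose monodromy fixes \<open>x\<close>
  also fixes \<open>y\<close>, which is \<open>stab\<close>.\<close>

lemma deck_transformation_exists:
  assumes "degree f > 0" "p \<notin> critical_values f" "x \<in> fibre f p" "y \<in> fibre f p"
    and stab: "\<And>\<gamma>. \<gamma> \<in> loops_at f p \<Longrightarrow> monodromy_perm f p \<gamma> x = x \<Longrightarrow> monodromy_perm f p \<gamma> y = y"
  obtains T where "continuous_on (- (poly f -` critical_values f)) T"
    "T \<in> - (poly f -` critical_values f) \<rightarrow> - (poly f -` critical_values f)"
    "T x = y" "\<And>z. z \<in> - (poly f -` critical_values f) \<Longrightarrow> poly f (T z) = poly f z"
proof -
  let ?U = "- (poly f -` critical_values f)"
  have xy: "x \<in> ?U" "y \<in> ?U" "poly f x = poly f y"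
    using assms(2-4) by (auto simp: fibre_def)
  note fin = finite_critical_fibres[OF assms(1)]
  have pc: "path_connected ?U"
    using fin by (intro path_connected_complement_countable) (auto intro: countable_finite)
  have lpc: "locally path_connected ?U"
    using fin by (intro open_imp_locally_path_connected open_Compl finite_imp_closed)
  \<comment> \<open>A loop \<open>r\<close> at \<open>x\<close> projects to a loop whose monodromy
    fixes \<open>x\<close>, hence also \<open>y\<close>; so the lift \<open>q\<close> of that
    projection starting at \<open>y\<close> closes up.\<close>
  have lift: "\<exists>q. path q \<and> path_image q \<subseteq> ?U \<and> pathstart q = y \<and> pathfinish q = y \<and>
                  homotopic_paths (- critical_values f) (poly f \<circ> r) (poly f \<circ> q)"
    if r: "path r" "path_image r \<subseteq> ?U" "pathstart r = x" "pathfinish r = x" for r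
  proof -
    have loop: "poly f \<circ> r \<in> loops_at f p"
      using r assms(3) by (intro poly_comp_loop) auto
    have "monodromy_perm f p (poly f \<circ> r) x = x"
      using monodromy_perm_lift[OF assms(1) is_lift_comp[OF r(1,2)], of p] r assms(3)
      by (simp add: fibre_def)
    then have "monodromy_perm f p (poly f \<circ> r) y = y"
      using stab loop by blast
    with loop_lift[OF assms(1) loop assms(4)] obtain q where
      q: "is_lift f (poly f \<circ> r) q" "pathstart q = y" "pathfinish q = y"
      by metis
    have "homotopic_paths (- critical_values f) (poly f \<circ> r) (poly f \<circ> q)"
      using loop q(1) by (intro homotopic_paths_eq) (auto simp: loops_at_def is_lift_def)
    with q show ?thesis
      by (auto simp: is_lift_def)
  qed
  show ?thesis
    by (rule covering_space_lift_general[OF covering_space_poly[OF assms(1)] xy(2,1) pc lpc _ _ xy(3) lift])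
      (auto intro!: that continuous_intros)
qed

lemma holomorphic_linear_growth_affine:
  assumes "f holomorphic_on UNIV" "\<And>z. cmod (f z) \<le> C * (1 + cmod z)"
  obtains a b where "f = (\<lambda>z. a * z + b)"
proof -
  have "C \<ge> 0"
    using order_trans[OF norm_ge_zero assms(2)[of 0]] by simp
  have eq: "f z = (\<Sum>k\<le>1. (deriv ^^ k) f 0 / fact k * z ^ k)" for z
  proof (rule Liouville_polynomial[OF assms(1)])
    fix w :: complex assume "1 \<le> cmod w"
    then have "C * (1 + cmod w) \<le> C * (2 * cmod w)"
      using \<open>C \<ge> 0\<close> by (intro mult_left_mono) auto
    then show "cmod (f w) \<le> (2 * C) * cmod w ^ 1"
      using assms(2)[of w] by simp
  qed
  show ?thesis
  proof (rule that)
    show "f = (\<lambda>z. deriv f 0 * z + f 0)"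
    proof
      show "f z = deriv f 0 * z + f 0" for z
        using eq[of z] by (simp add: atMost_Suc)
    qed
  qed
qed

theorem deck_transformation_affine:
  assumes "degree f > 0" "p \<notin> critical_values f" "x \<in> fibre f p" "y \<in> fibre f p"
    and "\<And>\<gamma>. \<gamma> \<in> loops_at f p \<Longrightarrow> monodromy_perm f p \<gamma> x = x \<Longrightarrow> monodromy_perm f p \<gamma> y = y"
  obtains a b where "\<And>z. poly f (a * z + b) = poly f z" "y = a * x + b"
proof -
  define S where "S = poly f -` critical_values f"
  obtain T where T: "continuous_on (- S) T" "T \<in> - S \<rightarrow> - S" "T x = y"
      "\<And>z. z \<in> - S \<Longrightarrow> poly f (T z) = poly f z"
    using deck_transformation_exists[OF assms] unfolding S_def by blast
  have "finite S"
    unfolding S_def by (rule finite_critical_fibres[OF assms(1)])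
  obtain C where C: "C > 0" "\<And>w z. poly f w = poly f z \<Longrightarrow> cmod w \<le> C * (1 + cmod z)"
    using poly_fibre_growth[OF assms(1)] by blast
  have bound: "cmod (T z) \<le> C * (1 + cmod z)" if "z \<in> - S" for z
    using T(4) C(2) that by blast
  have open_S: "open (- S)"
    using finite_imp_closed[OF \<open>finite S\<close>] by (rule open_Compl)
  have "T holomorphic_on (- S)"
    by (rule covering_space_lift_is_holomorphic[of "- S" "poly f" "- critical_values f" "poly f"])
      (use covering_space_poly[OF assms(1)] open_S T in \<open>auto simp: S_def\<close>)
  \<comment> \<open>In the unit ball around \<open>s\<close> the growth bound becomes a constant, so
    the singularity at \<open>s\<close> is removable.\<close>
  moreover have "T \<in> O[at s](\<lambda>_. 1)" if "s \<in> S" for s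
  proof (rule bigoI)
    have "eventually (\<lambda>z. z \<in> - (S - {s}) \<inter> ball s 1 \<and> z \<noteq> s) (at s)"
    proof -
      have "open (- (S - {s}) \<inter> ball s 1)"
        using \<open>finite S\<close> by (intro open_Int open_Compl finite_imp_closed) auto
      then show ?thesis
        unfolding eventually_at_topological by (intro exI[of _ "- (S - {s}) \<inter> ball s 1"]) auto
    qed
    then show "eventually (\<lambda>z. norm (T z) \<le> C * (2 + cmod s) * norm (1 :: complex)) (at s)"
    proof eventually_elim
      case (elim z)
      then have "cmod z \<le> 1 + cmod s"
        using norm_triangle_ineq2[of z s] by (auto simp: dist_norm norm_minus_commute)
      then have "C * (1 + cmod z) \<le> C * (2 + cmod s)"
        using C by (intro mult_left_mono) auto
      with bound[of z] elim show ?case by auto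
    qed
  qed
  ultimately obtain h where h: "h holomorphic_on UNIV" "\<And>z. z \<in> - S \<Longrightarrow> h z = T z"
    using removable_singularities[of S UNIV T] \<open>finite S\<close> by (auto simp: Compl_eq_Diff_UNIV)
  \<comment> \<open>The complement of the finite set \<open>S\<close> is dense, so closed conditions
    on the extension \<open>h\<close> need checking only where it equals \<open>T\<close>.\<close>
  have dense: "P z" if "closed {z. P z}" "\<And>z. z \<in> - S \<Longrightarrow> P z" for P and z :: complex
  proof -
    have "closure (- S) = UNIV"
      using \<open>finite S\<close> by (simp add: closure_complement empty_interior_finite)
    moreover have "closure (- S) \<subseteq> {z. P z}"
      using that by (intro closure_minimal) auto
    ultimately show ?thesis by auto
  qed
  have cont: "continuous_on UNIV h"
    using h(1) by (rule holomorphic_on_imp_continuous_on)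
  have "cmod (h z) \<le> C * (1 + cmod z)" for z
  proof (rule dense[of "\<lambda>z. cmod (h z) \<le> C * (1 + cmod z)"])
    show "closed {z. cmod (h z) \<le> C * (1 + cmod z)}"
      by (rule closed_Collect_le[OF continuous_on_norm[OF cont]]) (intro continuous_intros)
  qed (use bound h in auto)
  with h(1) obtain a b where ab: "h = (\<lambda>z. a * z + b)"
    by (rule holomorphic_linear_growth_affine)
  have "poly f (h z) = poly f z" for z
  proof (rule dense[of "\<lambda>z. poly f (h z) = poly f z"])
    show "closed {z. poly f (h z) = poly f z}"
      by (rule closed_Collect_eq[OF continuous_on_poly[OF cont] continuous_on_poly[OF continuous_on_id]])
  qed (use T h in auto)
  moreover have "y = a * x + b"
    using h(2)[of x] T(3) ab assms(2,3) by (simp add: S_def fibre_def)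
  ultimately show ?thesis
    using that ab by metis
qed

section \<open>The two sextics\<close>

lemma order_eqI:
  fixes f q :: "'a::idom poly"
  assumes "f = [:-a, 1:] ^ n * q" "poly q a \<noteq> 0"
  shows "Polynomial.order a f = n"
proof -
  have "q \<noteq> 0"
    using assms(2) by auto
  moreover have "Polynomial.order a q = 0"
    using assms(2) by (rule order_0I)
  ultimately show ?thesis
    using assms(1) by (simp add: order_mult order_power_n_n)
qed

lemma local_degree_eqI:
  assumes "f - [:v:] = [:-a, 1:] ^ n * q" "poly q a \<noteq> 0" "n > 0"
  shows "local_degree f a = n"
proof -
  have "poly (f - [:v:]) a = 0"
    using assms(1,3) by simp
  then have "poly f a = v" by simp
  with order_eqI[OF assms(1,2)] show ?thesis
    by (simp add: local_degree_def)
qed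

text \<open>The passport of a plane tree with six edges: a vertex of degree four over one critical
  value and two vertices of degree two over the other.\<close>

definition portrait_4_22 :: "complex poly \<Rightarrow> bool" where
  "portrait_4_22 f \<longleftrightarrow> (\<exists>u v. u \<noteq> v \<and> critical_values f = {u, v} \<and>
     critical_degrees f u = {#4#} \<and> critical_degrees f v = {#2, 2#})"

lemma same_critical_portrait_4_22:
  assumes "portrait_4_22 f" "portrait_4_22 g"
  shows "same_critical_portrait f g"
proof -
  obtain u v u' v' where f: "u \<noteq> v" "critical_values f = {u, v}"
      "critical_degrees f u = {#4#}" "critical_degrees f v = {#2, 2#}"
    and g: "u' \<noteq> v'" "critical_values g = {u', v'}"
      "critical_degrees g u' = {#4#}" "critical_degrees g v' = {#2, 2#}"
    using assms unfolding portrait_4_22_def by metis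
  then have "bij_betw (\<lambda>x. if x = u then u' else v') (critical_values f) (critical_values g)"
    by (auto simp: bij_betw_def inj_on_def)
  with f g show ?thesis
    unfolding same_critical_portrait_def by (intro exI[of _ "\<lambda>x. if x = u then u' else v'"]) auto
qed

text \<open>Local degrees are the exponents in the factorisations because the cofactors do not
  vanish at the critical points. A portrait thus reduces to polynomial identities.\<close>

lemma portrait_4_22I:
  assumes crit: "critical_points f = {c, a, b}" and "a \<noteq> b"
    and u: "f - [:u:] = [:-c, 1:] ^ 4 * q" "poly q c \<noteq> 0"
    and v: "f - [:v:] = [:-a, 1:] ^ 2 * [:-b, 1:] ^ 2 * r" "poly r a \<noteq> 0" "poly r b \<noteq> 0"
    and "u \<noteq> v"
  shows "portrait_4_22 f" "critical_values f = {u, v}"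
proof -
  have "poly (f - [:u:]) c = 0" "poly (f - [:v:]) a = 0" "poly (f - [:v:]) b = 0"
    using u(1) v(1) by simp_all
  then have val: "poly f c = u" "poly f a = v" "poly f b = v"
    by simp_all
  then show cv: "critical_values f = {u, v}"
    using crit by (auto simp: critical_values_def)
  have "local_degree f c = 4"
    using u by (intro local_degree_eqI) auto
  moreover have "local_degree f a = 2"
    using v \<open>a \<noteq> b\<close> by (intro local_degree_eqI[where q = "[:-b, 1:] ^ 2 * r"]) (auto simp: mult.assoc)
  moreover have "local_degree f b = 2"
    using v \<open>a \<noteq> b\<close> by (intro local_degree_eqI[where q = "[:-a, 1:] ^ 2 * r"]) (auto simp: mult_ac)
  moreover have "{z \<in> critical_points f. poly f z = u} = {c}"
      "{z \<in> critical_points f. poly f z = v} = {a, b}"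
    using crit val \<open>u \<noteq> v\<close> by auto
  ultimately have "critical_degrees f u = {#4#}" "critical_degrees f v = {#2, 2#}"
    using \<open>a \<noteq> b\<close> by (simp_all add: critical_degrees_def)
  with cv \<open>u \<noteq> v\<close> show "portrait_4_22 f"
    unfolding portrait_4_22_def by blast
qed

section \<open>Critical data and affine symmetries of the two polynomials\<close>

definition even_sextic :: "complex poly" where
  "even_sextic = [:0, 0, 0, 0, -3, 0, 2:]"

text \<open>Let the derivative be \<open>x^3 (x^2 + a x + b)\<close> up to a constant. Modulo the
  quadratic, the antiderivative vanishing at 0 has a linear coefficient proportional to
  \<open>a (2 a^2 - 3 b) (a^2 - 4 b)\<close>, which must be 0 if the two simple critical points
  share a value. Here \<open>a = 0\<close> gives \<open>even_sextic\<close> (with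
  \<open>b = -1\<close>), \<open>2 a^2 = 3 b\<close> with \<open>a = -1\<close> gives this
  polynomial, and \<open>a^2 = 4 b\<close> makes the two points collide.\<close>

definition primitive_sextic :: "complex poly" where
  "primitive_sextic = [:0, 0, 0, 0, 135, -162, 135:]"

lemma degree_even_sextic: "degree even_sextic = 6"
  by (simp add: even_sextic_def)

lemma degree_primitive_sextic: "degree primitive_sextic = 6"
  by (simp add: primitive_sextic_def)

lemma poly_even_sextic: "poly even_sextic z = 2 * z ^ 6 - 3 * z ^ 4"
  by (simp add: even_sextic_def algebra_simps power_numeral_reduce)

lemma poly_primitive_sextic: "poly primitive_sextic z = 27 * z ^ 4 * (5 * z\<^sup>2 - 6 * z + 5)"
  by (simp add: primitive_sextic_def algebra_simps power_numeral_reduce)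

lemma poly_pderiv_even_sextic:
  "poly (pderiv even_sextic) z = 12 * z ^ 3 * (z - 1) * (z + 1)"
  by (simp add: even_sextic_def pderiv_pCons algebra_simps power_numeral_reduce)

lemma poly_pderiv_primitive_sextic:
  "poly (pderiv primitive_sextic) z = 270 * z ^ 3 * (3 * z\<^sup>2 - 3 * z + 2)"
  by (simp add: primitive_sextic_def pderiv_pCons algebra_simps power_numeral_reduce)

lemma portrait_even_sextic:
  "portrait_4_22 even_sextic" "critical_values even_sextic = {0, -1}"
proof -
  have crit: "critical_points even_sextic = {0, 1, -1}"
    by (auto simp: critical_points_def poly_pderiv_even_sextic eq_neg_iff_add_eq_0)
  have u: "even_sextic - [:0:] = [:-0, 1:] ^ 4 * [:-3, 0, 2:]"
    by (simp add: even_sextic_def power_numeral_reduce)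
  have v: "even_sextic - [:-1:] = [:-1, 1:]\<^sup>2 * [:- (-1), 1:]\<^sup>2 * [:1, 0, 2:]"
    by (simp add: even_sextic_def power_numeral_reduce)
  show "portrait_4_22 even_sextic" "critical_values even_sextic = {0, -1}"
    using portrait_4_22I[OF crit _ u _ v] by simp_all
qed

lemma portrait_primitive_sextic: "portrait_4_22 primitive_sextic"
proof -
  define a b where "a = (3 + \<i> * sqrt 15) / 6" and "b = (3 - \<i> * sqrt 15) / 6"
  have "a \<noteq> b"
    by (simp add: a_def b_def complex_eq_iff)
  have sq: "complex_of_real (sqrt 15) * complex_of_real (sqrt 15) = 15"
    by (simp flip: of_real_mult)
  have ab: "a + b = 1" "a * b = 2 / 3"
    by (simp_all add: a_def b_def field_simps sq)
  have quad: "3 * z\<^sup>2 - 3 * z + 2 = 3 * (z - a) * (z - b)" for z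
  proof -
    have "3 * (z - a) * (z - b) = 3 * z\<^sup>2 - 3 * (a + b) * z + 3 * (a * b)"
      by (simp add: algebra_simps power2_eq_square)
    then show ?thesis by (simp add: ab)
  qed
  have crit: "critical_points primitive_sextic = {0, a, b}"
    by (auto simp: critical_points_def poly_pderiv_primitive_sextic quad)
  have u: "primitive_sextic - [:0:] = [:-0, 1:] ^ 4 * [:135, -162, 135:]"
    by (simp add: primitive_sextic_def power_numeral_reduce)
  \<comment> \<open>The product has rational coefficients, so the factorisation over the value -16
    is verified without \<open>sqrt 15\<close>.\<close>
  have prod: "[:-a, 1:] * [:-b, 1:] = [:2 / 3, -1, 1:]"
    using ab by (simp add: algebra_simps flip: ab(2))
  have "primitive_sextic - [:-16:] = ([:-a, 1:] * [:-b, 1:])\<^sup>2 * [:36, 108, 135:]"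
    unfolding prod by (simp add: primitive_sextic_def power_numeral_reduce)
  then have v: "primitive_sextic - [:-16:] = [:-a, 1:]\<^sup>2 * [:-b, 1:]\<^sup>2 * [:36, 108, 135:]"
    by (simp only: power_mult_distrib)
  \<comment> \<open>Subtracting 45 times the critical quadratic from the cofactor leaves
    \<open>243 z - 54\<close>, so the only candidate for a common root is
    \<open>2 / 9\<close>.\<close>
  have "poly [:36, 108, 135:] z \<noteq> 0" if "3 * z\<^sup>2 - 3 * z + 2 = 0" for z :: complex
  proof
    assume "poly [:36, 108, 135:] z = 0"
    then have "36 + 108 * z + 135 * z\<^sup>2 = 0"
      by (simp add: algebra_simps power2_eq_square)
    then have "243 * z = 54"
      using that by algebra
    then have "z = 2 / 9"
      by (simp add: field_simps)
    with that show False
      by (simp add: power2_eq_square)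
  qed
  then have "poly [:36, 108, 135:] a \<noteq> 0" "poly [:36, 108, 135:] b \<noteq> 0"
    using quad by auto
  with portrait_4_22I[OF crit \<open>a \<noteq> b\<close> u _ v] show ?thesis by simp
qed

text \<open>Differentiating at 0 shows that \<open>b\<close> is a critical point, and it has value
  0; the only such point is 0 itself. The coefficients in degrees 5 and 6 then give
  \<open>a ^ 5 = a ^ 6 = 1\<close>. The term of degree 5, absent from \<open>even_sextic\<close>, is
  what excludes negation.\<close>

lemma primitive_sextic_affine_symmetry:
  assumes "\<And>z. poly primitive_sextic (a * z + b) = poly primitive_sextic z"
  shows "a = 1" "b = 0"
proof -
  have eq: "pcompose primitive_sextic [:b, a:] = primitive_sextic"
    using assms by (intro poly_ext) (simp add: poly_pcompose add.commute mult.commute)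
  have "degree (pcompose primitive_sextic [:b, a:]) = 6"
    using eq degree_primitive_sextic by simp
  then have "a \<noteq> 0"
    by (auto simp: degree_pcompose)
  have "pderiv (pcompose primitive_sextic [:b, a:]) = pderiv primitive_sextic"
    using eq by simp
  then have "poly (pcompose (pderiv primitive_sextic) [:b, a:] * [:a:]) 0 = 0"
    by (simp add: pderiv_pcompose pderiv_pCons) (simp add: primitive_sextic_def pderiv_pCons)
  then have 1: "b ^ 3 * (3 * b\<^sup>2 - 3 * b + 2) = 0"
    using \<open>a \<noteq> 0\<close> by (simp add: poly_pcompose poly_pderiv_primitive_sextic)
  have 2: "b ^ 4 * (5 * b\<^sup>2 - 6 * b + 5) = 0"
    using assms[of 0] by (simp add: poly_primitive_sextic)
  show "b = 0"
  proof (rule ccontr)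
    assume "b \<noteq> 0"
    with 1 2 have "3 * b\<^sup>2 - 3 * b + 2 = 0" "5 * b\<^sup>2 - 6 * b + 5 = 0" by auto
    \<comment> \<open>Five times the first equation minus three times the second.\<close>
    then have "3 * b = 5" by algebra
    then have "b = 5 / 3" by (simp add: field_simps)
    with \<open>3 * b\<^sup>2 - 3 * b + 2 = 0\<close> show False by (simp add: power2_eq_square)
  qed
  then have "coeff (pcompose primitive_sextic [:0, a:]) i = coeff primitive_sextic i" for i
    using eq by simp
  from this[of 5] this[of 6] have "a ^ 5 = 1" "a ^ 6 = 1"
    by (simp_all add: coeff_pcompose_linear primitive_sextic_def numeral_eq_Suc)
  then show "a = 1"
    by (simp add: power_Suc[of a 5, simplified])
qed

section \<open>The monodromy groups\<close>

lemma poly_even_sextic_uminus: "poly even_sextic (- z) = poly even_sextic z"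
  by (simp add: poly_even_sextic)

lemma is_lift_uminus:
  assumes "is_lift even_sextic \<gamma> \<delta>"
  shows "is_lift even_sextic \<gamma> (\<lambda>t. - \<delta> t)"
proof -
  have "path (\<lambda>t. - \<delta> t)"
    using assms by (auto simp: is_lift_def path_def intro: continuous_intros)
  with assms show ?thesis
    by (auto simp: is_lift_def path_image_def poly_even_sextic_uminus)
qed

lemma monodromy_perm_uminus:
  assumes "\<gamma> \<in> loops_at even_sextic p" "x \<in> fibre even_sextic p"
  shows "monodromy_perm even_sextic p \<gamma> (- x) = - monodromy_perm even_sextic p \<gamma> x"
proof -
  have deg: "degree even_sextic > 0"
    by (simp add: degree_even_sextic)
  obtain \<delta> where \<delta>: "is_lift even_sextic \<gamma> \<delta>" "pathstart \<delta> = x"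
      "monodromy_perm even_sextic p \<gamma> x = pathfinish \<delta>"
    using loop_lift[OF deg assms] by blast
  show ?thesis
    using monodromy_perm_lift[OF deg is_lift_uminus[OF \<delta>(1)], of p] \<delta> assms(2)
    by (simp add: fibre_def pathstart_def pathfinish_def poly_even_sextic_uminus)
qed

section \<open>The monodromy of \<open>even_sextic\<close> along a large circle\<close>

lemma power_6_diff_1_near_1:
  fixes w :: complex
  assumes "cmod (w - 1) \<le> 1/10"
  shows "4 * cmod (w - 1) \<le> cmod (w ^ 6 - 1)"
proof -
  define h where "h = w - 1"
  have h: "cmod h \<le> 1/10" "w = 1 + h"
    using assms by (auto simp: h_def)
  define e where "e = 15 + 20 * h + 15 * h\<^sup>2 + 6 * h ^ 3 + h ^ 4"
  have eq: "w ^ 6 - 1 = h * (6 + h * e)"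
    unfolding h(2) e_def by algebra
  have "cmod e \<le> cmod 15 + cmod (20 * h) + cmod (15 * h\<^sup>2) + cmod (6 * h ^ 3) + cmod (h ^ 4)"
    unfolding e_def by (intro norm_triangle_le add_mono order_refl)
  also have "\<dots> \<le> 15 + 2 + 15 / 100 + 6 / 1000 + 1 / 10000"
    using power_mono[OF h(1), of 2] power_mono[OF h(1), of 3] power_mono[OF h(1), of 4] h(1)
    by (simp add: norm_mult norm_power power_divide)
  finally have "cmod e \<le> 20" by simp
  then have "cmod (h * e) \<le> 1/10 * 20"
    unfolding norm_mult using h(1) by (intro mult_mono) auto
  then have "4 \<le> cmod (6 + h * e)"
    using norm_triangle_ineq2[of 6 "- (h * e)"] by simp
  then have "cmod h * 4 \<le> cmod h * cmod (6 + h * e)"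
    by (intro mult_left_mono) auto
  then show ?thesis
    by (simp add: eq norm_mult h_def mult.commute)
qed

text \<open>Near 1 the sixth power stretches distances to 1 by at least 4, the fourth power by at
  most 5. An equation weighting the sixth power heavily enough therefore forces
  \<open>w = 1\<close>.\<close>

lemma power_4_diff_1_near_1:
  fixes w :: complex
  assumes "cmod (w - 1) \<le> 1/10"
  shows "cmod (w ^ 4 - 1) \<le> 5 * cmod (w - 1)"
proof -
  define h where "h = w - 1"
  have h: "cmod h \<le> 1/10" "w = 1 + h"
    using assms by (auto simp: h_def)
  have eq: "w ^ 4 - 1 = h * (4 + 6 * h + 4 * h\<^sup>2 + h ^ 3)"
    unfolding h(2) by algebra
  have "cmod (4 + 6 * h + 4 * h\<^sup>2 + h ^ 3) \<le> cmod 4 + cmod (6 * h) + cmod (4 * h\<^sup>2) + cmod (h ^ 3)"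
    by (intro norm_triangle_le add_mono order_refl)
  also have "\<dots> \<le> 5"
    using power_mono[OF h(1), of 2] power_mono[OF h(1), of 3] h(1)
    by (simp add: norm_mult norm_power power_divide)
  finally have "cmod h * cmod (4 + 6 * h + 4 * h\<^sup>2 + h ^ 3) \<le> cmod h * 5"
    by (intro mult_left_mono) auto
  then show ?thesis
    by (simp add: eq norm_mult h_def mult.commute)
qed

lemma cmod_even_sextic_root:
  assumes "poly even_sextic a = 20000"
  shows "cmod a \<ge> 4"
proof (rule ccontr)
  assume "\<not> cmod a \<ge> 4"
  then have "cmod a \<le> 4" by simp
  have "20000 = cmod (2 * a ^ 6 - 3 * a ^ 4)"
    using assms by (simp add: poly_even_sextic)
  also have "\<dots> \<le> cmod (2 * a ^ 6) + cmod (3 * a ^ 4)"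
    by (rule norm_triangle_ineq4)
  also have "\<dots> \<le> 2 * 4 ^ 6 + 3 * 4 ^ 4"
    unfolding norm_mult norm_power using \<open>cmod a \<le> 4\<close>
    by (intro add_mono mult_mono power_mono) auto
  finally show False by simp
qed

text \<open>Three turns around both critical values: far out a lift behaves like a sixth root and
  makes half a turn. The radius 20000 exceeds \<open>2 * 4 ^ 6 + 3 * 4 ^ 4 = 8960\<close>, so lifts
  start at modulus at least 4.\<close>

definition big_loop :: "real \<Rightarrow> complex" where
  "big_loop t = 20000 * cis (6 * pi * t)"

lemma big_loop_in_loops: "big_loop \<in> loops_at even_sextic 20000"
proof -
  have "path big_loop"
    unfolding path_def big_loop_def by (intro continuous_intros)
  moreover have "cmod z = 20000" if "z \<in> path_image big_loop" for z
    using that by (auto simp: path_image_def big_loop_def norm_mult)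
  then have "path_image big_loop \<subseteq> - critical_values even_sextic"
    by (force simp: portrait_even_sextic(2))
  moreover have "cis (6 * pi) = 1"
    using cis_multiple_2pi[of 3] by (simp add: mult.assoc mult.commute)
  ultimately show ?thesis
    by (simp add: loops_at_def pathstart_def pathfinish_def big_loop_def)
qed

text \<open>Along a lift of \<^const>\<open>big_loop\<close>, the direction of the point turns by a half turn up to
  an error that is too small to move it towards another point of the fibre.\<close>

lemma lift_big_loop:
  assumes "is_lift even_sextic big_loop \<delta>"
  shows "pathfinish \<delta> = - pathstart \<delta>"
proof -
  define a where "a = \<delta> 0"
  \<comment> \<open>The lift with the expected half turn divided out, normalised to start at 1. The
    goal becomes \<open>w 1 = 1\<close>.\<close>
  define w where "w t = \<delta> t * cis (- pi * t) / a" for t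
  have val: "2 * \<delta> t ^ 6 - 3 * \<delta> t ^ 4 = 20000 * cis (6 * pi * t)" if "t \<in> {0..1}" for t
    using assms that by (simp add: is_lift_def big_loop_def poly_even_sextic)
  from val[of 0] have a0: "2 * a ^ 6 - 3 * a ^ 4 = 20000"
    by (simp add: a_def)
  then have a4: "cmod a \<ge> 4"
    by (intro cmod_even_sextic_root) (simp add: poly_even_sextic)
  then have "a \<noteq> 0" by auto
  have "32 \<le> 2 * cmod a ^ 2"
    using power_mono[OF a4, of 2] by simp
  have key: "2 * a\<^sup>2 * (w t ^ 6 - 1) = 3 * (w t ^ 4 * cis (- 2 * pi * t) - 1)" if t: "t \<in> {0..1}" for t
  proof -
    define u where "u = cis (- pi * t)"
    have "u * cis (pi * t) = 1" "u ^ 6 * cis (6 * pi * t) = 1" "u\<^sup>2 = cis (- 2 * pi * t)"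
      by (simp_all add: u_def Complex.DeMoivre cis_mult mult.assoc)
    moreover have "a * w t = \<delta> t * u"
      using \<open>a \<noteq> 0\<close> by (simp add: w_def u_def)
    ultimately have "2 * (a * w t) ^ 6 - 3 * (a * w t) ^ 4 * cis (- 2 * pi * t) = 20000"
      using val[OF t] by algebra
    moreover have "a ^ 4 * (2 * a\<^sup>2 * (w t ^ 6 - 1)) - a ^ 4 * (3 * (w t ^ 4 * cis (- 2 * pi * t) - 1)) =
        (2 * (a * w t) ^ 6 - 3 * (a * w t) ^ 4 * cis (- 2 * pi * t)) - (2 * a ^ 6 - 3 * a ^ 4)"
      by algebra
    ultimately have "a ^ 4 * (2 * a\<^sup>2 * (w t ^ 6 - 1)) = a ^ 4 * (3 * (w t ^ 4 * cis (- 2 * pi * t) - 1))"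
      using a0 by simp
    then show ?thesis
      using \<open>a \<noteq> 0\<close> by simp
  qed
  \<comment> \<open>A barrier: on this circle the left side of \<open>key\<close> has modulus at
    least 12.8 and the right side less than 7.4. By continuity \<open>w\<close> never crosses
    it.\<close>
  have ne: "cmod (w t - 1) \<noteq> 1/10" if t: "t \<in> {0..1}" for t
  proof
    assume eq: "cmod (w t - 1) = 1/10"
    then have "cmod (w t) \<le> 1 + 1/10"
      using norm_triangle_ineq2[of "w t" 1] by simp
    have "32 * (4 * (1/10)) \<le> (2 * cmod a ^ 2) * cmod (w t ^ 6 - 1)"
      using power_6_diff_1_near_1[of "w t"] eq \<open>32 \<le> _\<close> by (intro mult_mono) auto
    also have "\<dots> = cmod (2 * a\<^sup>2 * (w t ^ 6 - 1))"
      by (simp only: norm_mult norm_power norm_numeral)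
    also have "\<dots> \<le> 3 * (cmod (w t) ^ 4 + 1)"
      unfolding key[OF t] norm_mult
      using norm_triangle_ineq4[of "w t ^ 4 * cis (- 2 * pi * t)" 1] by (simp add: norm_mult norm_power)
    also have "\<dots> \<le> 3 * ((1 + 1/10) ^ 4 + 1)"
      using \<open>cmod (w t) \<le> _\<close> by (intro mult_left_mono add_mono power_mono) auto
    finally show False
      by (simp add: power_divide)
  qed
  have near: "cmod (w 1 - 1) \<le> 1/10"
  proof (rule ccontr)
    assume "\<not> cmod (w 1 - 1) \<le> 1/10"
    moreover have "w 0 = 1"
      using \<open>a \<noteq> 0\<close> by (simp add: w_def a_def)
    moreover have "continuous_on {0..1} (\<lambda>t. cmod (w t - 1))"
      using assms \<open>a \<noteq> 0\<close> unfolding w_def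
      by (intro continuous_intros) (auto simp: is_lift_def path_def)
    ultimately have "\<exists>t\<ge>0. t \<le> 1 \<and> cmod (w t - 1) = 1/10"
      using IVT'[of "\<lambda>t. cmod (w t - 1)" 0 "1/10" 1] by simp
    with ne show False by auto
  qed
  have "cis (- 2 * pi) = 1"
    using cis_multiple_2pi[of "-1"] by simp
  \<comment> \<open>At time 1 the twist in \<open>key\<close> is 1, so both sides vanish at
    \<open>w 1 = 1\<close>, and the two estimates near 1 compare their sizes: 128 against
    15.\<close>
  then have "32 * (4 * cmod (w 1 - 1)) \<le> 3 * (5 * cmod (w 1 - 1))"
  proof -
    have "32 * (4 * cmod (w 1 - 1)) \<le> (2 * cmod a ^ 2) * cmod (w 1 ^ 6 - 1)"
      using power_6_diff_1_near_1[OF near] \<open>32 \<le> _\<close> by (intro mult_mono) auto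
    also have "\<dots> = cmod (2 * a\<^sup>2 * (w 1 ^ 6 - 1))"
      by (simp only: norm_mult norm_power norm_numeral)
    also have "2 * a\<^sup>2 * (w 1 ^ 6 - 1) = 3 * (w 1 ^ 4 - 1)"
      using key[of 1] \<open>cis (- 2 * pi) = 1\<close> by simp
    also have "cmod (3 * (w 1 ^ 4 - 1)) = 3 * cmod (w 1 ^ 4 - 1)"
      by (simp only: norm_mult norm_numeral)
    also have "\<dots> \<le> 3 * (5 * cmod (w 1 - 1))"
      using power_4_diff_1_near_1[OF near] by simp
    finally show ?thesis .
  qed
  then have "w 1 = 1" by simp
  moreover have "cis (- pi) = - 1"
    by (simp add: complex_eq_iff)
  ultimately have "- \<delta> 1 = a"
    using \<open>a \<noteq> 0\<close> by (simp add: w_def field_simps)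
  then show ?thesis
    unfolding a_def pathfinish_def pathstart_def by (metis minus_minus)
qed

lemma uminus_in_monodromy_group:
  assumes "p \<notin> critical_values even_sextic"
  obtains \<gamma> where "\<gamma> \<in> loops_at even_sextic p"
    "\<And>x. x \<in> fibre even_sextic p \<Longrightarrow> monodromy_perm even_sextic p \<gamma> x = - x"
proof -
  have deg: "degree even_sextic > 0"
    by (simp add: degree_even_sextic)
  have "path_connected (- critical_values even_sextic)"
    using finite_critical_values[OF deg]
    by (intro path_connected_complement_countable) (auto intro: countable_finite)
  moreover have "20000 \<in> - critical_values even_sextic"
    by (simp add: portrait_even_sextic(2))
  ultimately obtain \<eta> where \<eta>: "path \<eta>" "path_image \<eta> \<subseteq> - critical_values even_sextic"
      "pathstart \<eta> = p" "pathfinish \<eta> = 20000"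
    using assms unfolding path_connected_def by (metis ComplI)
  define \<gamma> where "\<gamma> = \<eta> +++ (big_loop +++ reversepath \<eta>)"
  have "\<gamma> \<in> loops_at even_sextic p"
    using \<eta> big_loop_in_loops by (auto simp: \<gamma>_def loops_at_def path_image_join)
  moreover have "monodromy_perm even_sextic p \<gamma> x = - x" if x: "x \<in> fibre even_sextic p" for x
  proof -
    obtain \<delta> where \<delta>: "is_lift even_sextic \<eta> \<delta>" "pathstart \<delta> = x"
      using is_lift_exists[OF deg \<eta>(1,2), of x] x \<eta>(3) by (auto simp: fibre_def)
    have "poly even_sextic (pathfinish \<delta>) = 20000"
      using \<delta>(1) \<eta>(4) by (simp add: is_lift_def pathfinish_def)
    then obtain \<epsilon> where \<epsilon>: "is_lift even_sextic big_loop \<epsilon>" "pathstart \<epsilon> = pathfinish \<delta>"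
      using is_lift_exists[OF deg, of big_loop] big_loop_in_loops by (auto simp: loops_at_def)
    \<comment> \<open>By evenness the negative of \<open>\<delta>\<close> also lifts
      \<open>\<eta>\<close>. Since \<open>big_loop\<close> takes the end of \<open>\<delta>\<close>
      to its negative, this path run backwards leads from there to \<open>- x\<close>.\<close>
    define \<zeta> where "\<zeta> = reversepath (\<lambda>t. - \<delta> t)"
    have \<zeta>: "is_lift even_sextic (reversepath \<eta>) \<zeta>"
      unfolding \<zeta>_def by (intro is_lift_reversepath is_lift_uminus \<delta>)
    have "pathstart \<zeta> = pathfinish \<epsilon>" "pathfinish \<zeta> = - x"
      using lift_big_loop[OF \<epsilon>(1)] \<epsilon>(2) \<delta>(2)
      by (simp_all add: \<zeta>_def pathstart_def pathfinish_def reversepath_def)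
    then have "is_lift even_sextic \<gamma> (\<delta> +++ (\<epsilon> +++ \<zeta>))"
      unfolding \<gamma>_def using \<delta> \<epsilon> \<zeta> by (intro is_lift_join) auto
    from monodromy_perm_lift[OF deg this, of p] show ?thesis
      using \<open>pathfinish \<zeta> = - x\<close> \<delta>(2) x by (simp add: fibre_def)
  qed
  ultimately show ?thesis by (rule that)
qed

section \<open>Comparison of the centres\<close>

lemma monodromy_perm_const:
  assumes "degree f > 0" "p \<notin> critical_values f"
  shows "linepath p p \<in> loops_at f p" "monodromy_perm f p (linepath p p) = (\<lambda>x\<in>fibre f p. x)"
proof -
  show "linepath p p \<in> loops_at f p"
    using assms(2) by (simp add: loops_at_def)
  have "monodromy_perm f p (linepath p p) x = x" if "x \<in> fibre f p" for x
  proof -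
    have "is_lift f (linepath p p) (linepath x x)"
      using that assms(2) by (auto simp: is_lift_def fibre_def linepath_refl path_image_def path_def)
    from monodromy_perm_lift[OF assms(1) this, of p] that show ?thesis
      by (simp add: fibre_def)
  qed
  then show "monodromy_perm f p (linepath p p) = (\<lambda>x\<in>fibre f p. x)"
    by (auto simp: monodromy_perm_def)
qed

text \<open>If the permutation of \<open>\<gamma>\<close> fixes \<open>x\<close> and commutes with
  that of \<open>\<tau>\<close>, it fixes the image of \<open>x\<close> under \<open>\<tau>\<close>.
  This is the stabiliser condition for an affine symmetry taking \<open>x\<close> to that image, and
  only the identity is available.\<close>

lemma primitive_sextic_central_monodromy:
  assumes "q \<notin> critical_values primitive_sextic" "\<tau> \<in> loops_at primitive_sextic q"
    and comm: "\<And>\<gamma>. \<gamma> \<in> loops_at primitive_sextic q \<Longrightarrow>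
      monodromy_perm primitive_sextic q \<gamma> \<otimes>\<^bsub>monodromy_group primitive_sextic q\<^esub> monodromy_perm primitive_sextic q \<tau> =
      monodromy_perm primitive_sextic q \<tau> \<otimes>\<^bsub>monodromy_group primitive_sextic q\<^esub> monodromy_perm primitive_sextic q \<gamma>"
  shows "monodromy_perm primitive_sextic q \<tau> = (\<lambda>x\<in>fibre primitive_sextic q. x)"
proof -
  let ?m = "monodromy_perm primitive_sextic q"
  have deg: "degree primitive_sextic > 0"
    by (simp add: degree_primitive_sextic)
  have "?m \<tau> x = x" if x: "x \<in> fibre primitive_sextic q" for x
  proof -
    have y: "?m \<tau> x \<in> fibre primitive_sextic q"
      using loop_lift[OF deg assms(2) x] by metis
    have stab: "?m \<gamma> (?m \<tau> x) = ?m \<tau> x" if "\<gamma> \<in> loops_at primitive_sextic q" "?m \<gamma> x = x" for \<gamma>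
      using fun_cong[OF comm[OF that(1)], of x] x that assms(2)
      by (simp add: monodromy_group_mult[OF deg] compose_eq)
    obtain a b where ab: "\<And>z. poly primitive_sextic (a * z + b) = poly primitive_sextic z"
        "?m \<tau> x = a * x + b"
      using deck_transformation_affine[OF deg assms(1) x y stab] by blast
    with primitive_sextic_affine_symmetry[OF ab(1)] show ?thesis by simp
  qed
  then show ?thesis
    by (auto simp: monodromy_perm_def)
qed

lemma monodromy_groups_not_iso:
  assumes p: "p \<notin> critical_values even_sextic" and q: "q \<notin> critical_values primitive_sextic"
  shows "\<not> monodromy_group even_sextic p \<cong> monodromy_group primitive_sextic q"
proof
  let ?F = "monodromy_group even_sextic p" and ?G = "monodromy_group primitive_sextic q"
  let ?m = "monodromy_perm even_sextic p" and ?n = "monodromy_perm primitive_sextic q"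
  have df: "degree even_sextic > 0" and dg: "degree primitive_sextic > 0"
    by (simp_all add: degree_even_sextic degree_primitive_sextic)
  assume "?F \<cong> ?G"
  then obtain h where h: "h \<in> hom ?F ?G" "bij_betw h (carrier ?F) (carrier ?G)"
    by (auto simp: is_iso_def iso_def)
  obtain \<gamma> where \<gamma>: "\<gamma> \<in> loops_at even_sextic p" "\<And>x. x \<in> fibre even_sextic p \<Longrightarrow> ?m \<gamma> x = - x"
    using uminus_in_monodromy_group[OF p] by blast
  have in_F: "?m \<alpha> \<in> carrier ?F" if "\<alpha> \<in> loops_at even_sextic p" for \<alpha>
    using that by (simp add: carrier_monodromy_group)
  have central: "?m \<alpha> \<otimes>\<^bsub>?F\<^esub> ?m \<gamma> = ?m \<gamma> \<otimes>\<^bsub>?F\<^esub> ?m \<alpha>" if \<alpha>: "\<alpha> \<in> loops_at even_sextic p" for \<alpha>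
  proof -
    have "?m \<alpha> (?m \<gamma> x) = ?m \<gamma> (?m \<alpha> x)" if x: "x \<in> fibre even_sextic p" for x
    proof -
      have "?m \<alpha> x \<in> fibre even_sextic p"
        using loop_lift[OF df \<alpha> x] by metis
      then show ?thesis
        using \<gamma>(2) x monodromy_perm_uminus[OF \<alpha> x] by simp
    qed
    then show ?thesis
      unfolding monodromy_group_mult[OF df \<alpha> \<gamma>(1)] monodromy_group_mult[OF df \<gamma>(1) \<alpha>] compose_def
      by (rule restrict_ext)
  qed
  have comm: "h (?m \<alpha>) \<otimes>\<^bsub>?G\<^esub> h (?m \<gamma>) = h (?m \<gamma>) \<otimes>\<^bsub>?G\<^esub> h (?m \<alpha>)"
    if "\<alpha> \<in> loops_at even_sextic p" for \<alpha>
    using hom_mult[OF h(1) in_F[OF that] in_F[OF \<gamma>(1)]]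
      hom_mult[OF h(1) in_F[OF \<gamma>(1)] in_F[OF that]] central[OF that] by simp
  have in_G: "\<exists>\<beta>\<in>loops_at primitive_sextic q. h (?m \<alpha>) = ?n \<beta>" if "\<alpha> \<in> loops_at even_sextic p" for \<alpha>
    using bspec[OF bij_betwE[OF h(2)] in_F[OF that]] by (auto simp: carrier_monodromy_group)
  have from_F: "\<exists>\<alpha>\<in>loops_at even_sextic p. ?n \<beta> = h (?m \<alpha>)" if "\<beta> \<in> loops_at primitive_sextic q" for \<beta>
    using bij_betw_imp_surj_on[OF h(2)] that by (force simp: carrier_monodromy_group)
  obtain \<tau> where \<tau>: "\<tau> \<in> loops_at primitive_sextic q" "h (?m \<gamma>) = ?n \<tau>"
    using in_G[OF \<gamma>(1)] by blast
  have "?n \<beta> \<otimes>\<^bsub>?G\<^esub> ?n \<tau> = ?n \<tau> \<otimes>\<^bsub>?G\<^esub> ?n \<beta>" if \<beta>: "\<beta> \<in> loops_at primitive_sextic q" for \<beta>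
  proof -
    obtain \<alpha> where "\<alpha> \<in> loops_at even_sextic p" "?n \<beta> = h (?m \<alpha>)"
      using from_F[OF \<beta>] by blast
    with comm[of \<alpha>] \<tau>(2) show ?thesis by simp
  qed
  then have trivial: "h (?m \<gamma>) = (\<lambda>x\<in>fibre primitive_sextic q. x)"
    unfolding \<tau>(2) by (rule primitive_sextic_central_monodromy[OF q \<tau>(1)])
  let ?c = "linepath p p"
  note c = monodromy_perm_const[OF df p]
  \<comment> \<open>The identity permutation is tracked through \<open>h\<close> as an idempotent:
    its image is an idempotent bijection of the fibre, hence the identity. Injectivity of
    \<open>h\<close> then identifies negation with the identity.\<close>
  have "?m ?c \<otimes>\<^bsub>?F\<^esub> ?m ?c = ?m ?c"
    using monodromy_group_mult[OF df c(1) c(1)] by (simp add: c(2) compose_def cong: restrict_cong)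
  then have idem: "h (?m ?c) \<otimes>\<^bsub>?G\<^esub> h (?m ?c) = h (?m ?c)"
    using hom_mult[OF h(1) in_F[OF c(1)] in_F[OF c(1)]] by simp
  obtain \<epsilon> where \<epsilon>: "\<epsilon> \<in> loops_at primitive_sextic q" "h (?m ?c) = ?n \<epsilon>"
    using in_G[OF c(1)] by blast
  have "?n \<epsilon> x = x" if x: "x \<in> fibre primitive_sextic q" for x
  proof -
    have "?n \<epsilon> (?n \<epsilon> x) = ?n \<epsilon> x"
      using fun_cong[OF idem, of x] x by (simp add: \<epsilon> monodromy_group_mult[OF dg] compose_eq)
    moreover have "?n \<epsilon> x \<in> fibre primitive_sextic q"
      using loop_lift[OF dg \<epsilon>(1) x] by metis
    ultimately show ?thesis
      using monodromy_perm_Bij[OF dg \<epsilon>(1)] x by (auto simp: Bij_def bij_betw_def inj_on_def)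
  qed
  then have "h (?m ?c) = (\<lambda>x\<in>fibre primitive_sextic q. x)"
    unfolding \<epsilon>(2) by (auto simp: monodromy_perm_def)
  then have "?m \<gamma> = ?m ?c"
    using trivial by (intro inj_onD[OF bij_betw_imp_inj_on[OF h(2)] _ in_F[OF \<gamma>(1)] in_F[OF c(1)]]) simp
  obtain x where "poly even_sextic x = p"
    using poly_surj_complex[OF df] .
  then have x: "x \<in> fibre even_sextic p"
    by (simp add: fibre_def)
  \<comment> \<open>So \<open>x\<close> is 0 and \<open>p\<close> is 0, which is a critical value of
    \<open>even_sextic\<close>.\<close>
  then have "- x = x"
    using \<gamma>(2)[of x] \<open>?m \<gamma> = ?m ?c\<close> c(2) by simp
  then have "p = 0"
    using \<open>poly even_sextic x = p\<close> by (simp add: poly_even_sextic)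
  with p show False
    by (simp add: portrait_even_sextic(2))
qed

theorem theorem2p2:
  "\<exists>f g :: complex poly.
     degree f = 6 \<and> degree g = 6 \<and>
     (\<forall>i. coeff f i \<in> \<real>) \<and> (\<forall>i. coeff g i \<in> \<real>) \<and>
     same_critical_portrait f g \<and>
     (\<forall>p q. p \<notin> critical_values f \<longrightarrow> q \<notin> critical_values g \<longrightarrow>
        \<not> monodromy_group f p \<cong> monodromy_group g q)"
proof (intro exI conjI)
  show "degree even_sextic = 6" "degree primitive_sextic = 6"
    by (rule degree_even_sextic degree_primitive_sextic)+
  show "\<forall>i. coeff even_sextic i \<in> \<real>" "\<forall>i. coeff primitive_sextic i \<in> \<real>"
    by (auto simp: even_sextic_def primitive_sextic_def coeff_pCons split: nat.split)
  show "same_critical_portrait even_sextic primitive_sextic"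
    using portrait_even_sextic(1) portrait_primitive_sextic by (rule same_critical_portrait_4_22)
  show "\<forall>p q. p \<notin> critical_values even_sextic \<longrightarrow> q \<notin> critical_values primitive_sextic \<longrightarrow>
      \<not> monodromy_group even_sextic p \<cong> monodromy_group primitive_sextic q"
    using monodromy_groups_not_iso by blast
qed

end
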